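(* Any expander sequence $\{G_i\}$ of finite graphs is an expander light sequence.
   Context: Graphs are undirected; a graph $G$ has vertex set $V(G)$ and edge set $E(G)$, and $|G|$ is the number of vertices. Connected graphs carry the graph metric on their vertex sets. Subsets of $G$ mean subsets of $V(G)$. For $A\subseteq V(G)$, $\partial A$ is the set of edges joining a vertex of $A$ to a vertex outside $A$. The Cheeger constant of a finite graph is $h(G)=\min\{|\partial A|/|A| : A\subseteq V(G),\ 0<|A|\le |V(G)|/2\}$. A finite graph $G$ is a $(k,\varepsilon)$-expander if each vertex has degree at most $k$ and $h(G)\ge\varepsilon>0$. A sequence of finite connected graphs $\{G_i\}$ is a graph sequence if $|G_i|\to\infty$. A graph sequence $\{G_i\}$ is an expander sequence if there exist $k,\varepsilon$ such that each $G_i$ is a $(k,\varepsilon)$-expander. For a subset $A$ of a finite graph $G$, $\operatorname{halo}(A)$ is the set of vertices not in $A$ whose (open) $2$-ball in the graph metric intersects $A$, i.e. vertices outside $A$ adjacent to a vertex of $A$. A graph sequence $\{G_i\}$ is an expander light sequence if there is $c>0$ such that for any uniformly bounded sequence of subsets $A_n\subset G_n$ (i.e. the diameters of the $A_n$ in the graph metrics of the $G_n$ are bounded by a common finite constant) one has $|\operatorname{halo}(A_n)|\ge c\cdot|A_n|$ for infinitely many $n$. *)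

theory Defs
  imports Complex_Main "HOL-Library.Extended_Real"
begin

record 'a graph =
  verts :: "'a set"
  edges :: "'a set set"

text \<open>Simple undirected graphs: an edge is the two-element set of its endpoints.\<close>

definition finite_graph :: "'a graph \<Rightarrow> bool" where
  "finite_graph G \<longleftrightarrow> finite (verts G) \<and> (\<forall>e\<in>edges G. e \<subseteq> verts G \<and> card e = 2)"

definition adj :: "'a graph \<Rightarrow> ('a \<times> 'a) set" where
  "adj G = {(u, v). {u, v} \<in> edges G}"

definition connected_graph :: "'a graph \<Rightarrow> bool" where
  "connected_graph G \<longleftrightarrow>
     verts G \<noteq> {} \<and> (\<forall>u\<in>verts G. \<forall>v\<in>verts G. (u, v) \<in> (adj G)\<^sup>*)"

text \<open>The graph metric (length of a shortest walk); only meaningful between vertices of a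
  connected graph.\<close>

definition gdist :: "'a graph \<Rightarrow> 'a \<Rightarrow> 'a \<Rightarrow> nat" where
  "gdist G u v = (LEAST n. (u, v) \<in> adj G ^^ n)"

text \<open>On \<^typ>\<open>nat\<close>, \<^const>\<open>Sup\<close> is the maximum of a finite nonempty set, and
  the supremum of the empty set is 0; so the empty subset has diameter 0.\<close>

definition gdiam :: "'a graph \<Rightarrow> 'a set \<Rightarrow> nat" where
  "gdiam G A = (SUP (u, v)\<in>A \<times> A. gdist G u v)"

definition open_gball :: "'a graph \<Rightarrow> 'a \<Rightarrow> nat \<Rightarrow> 'a set" where
  "open_gball G v r = {u \<in> verts G. gdist G v u < r}"

definition halo :: "'a graph \<Rightarrow> 'a set \<Rightarrow> 'a set" where
  "halo G A = {v \<in> verts G - A. open_gball G v 2 \<inter> A \<noteq> {}}"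

definition edge_boundary :: "'a graph \<Rightarrow> 'a set \<Rightarrow> 'a set set" where
  "edge_boundary G A = {e \<in> edges G. \<exists>u\<in>A. \<exists>v\<in>verts G - A. e = {u, v}}"

definition vertex_degree :: "'a graph \<Rightarrow> 'a \<Rightarrow> nat" where
  "vertex_degree G v = card {e \<in> edges G. v \<in> e}"

text \<open>For a finite graph with at least two vertices the infimum ranges over a finite nonempty
  set and is a minimum. If there are fewer vertices, no admissible set exists, and the
  minimum over the empty family is read as \<open>\<infinity>\<close>.\<close>

definition cheeger :: "'a graph \<Rightarrow> ereal" where
  "cheeger G =
     (INF A\<in>{A. A \<subseteq> verts G \<and> 0 < card A \<and> real (card A) \<le> real (card (verts G)) / 2}.
        ereal (real (card (edge_boundary G A)) / real (card A)))"

definition expander :: "nat \<Rightarrow> real \<Rightarrow> 'a graph \<Rightarrow> bool" where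
  "expander k \<epsilon> G \<longleftrightarrow>
     finite_graph G \<and> (\<forall>v\<in>verts G. vertex_degree G v \<le> k) \<and>
     cheeger G \<ge> ereal \<epsilon> \<and> \<epsilon> > 0"

definition graph_sequence :: "(nat \<Rightarrow> 'a graph) \<Rightarrow> bool" where
  "graph_sequence G \<longleftrightarrow>
     (\<forall>i. finite_graph (G i) \<and> connected_graph (G i)) \<and>
     filterlim (\<lambda>i. card (verts (G i))) at_top sequentially"

definition expander_sequence :: "(nat \<Rightarrow> 'a graph) \<Rightarrow> bool" where
  "expander_sequence G \<longleftrightarrow> graph_sequence G \<and> (\<exists>k \<epsilon>. \<forall>i. expander k \<epsilon> (G i))"

definition uniformly_bounded :: "(nat \<Rightarrow> 'a graph) \<Rightarrow> (nat \<Rightarrow> 'a set) \<Rightarrow> bool" where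
  "uniformly_bounded G A \<longleftrightarrow> (\<exists>D. \<forall>n. gdiam (G n) (A n) \<le> D)"

definition expander_light_sequence :: "(nat \<Rightarrow> 'a graph) \<Rightarrow> bool" where
  "expander_light_sequence G \<longleftrightarrow>
     graph_sequence G \<and>
     (\<exists>c::real. c > 0 \<and>
       (\<forall>A. (\<forall>n. A n \<subseteq> verts (G n)) \<and> uniformly_bounded G A \<longrightarrow>
          infinite {n. real (card (halo (G n) (A n))) \<ge> c * real (card (A n))}))"

end

theory Submission
  imports Defs
begin

text \<open>In a graph of degree at most \<open>k\<close>, a set of diameter at most \<open>D\<close> has at most
  \<open>1 + k + \<dots> + k ^ D\<close> vertices. Since the orders of the graphs tend to infinity, the sets
  of a uniformly bounded sequence eventually fill at most half of their graphs, so the Cheeger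
  constant bounds their edge boundaries from below. Every boundary edge ends in a halo vertex, and
  a halo vertex lies on at most \<open>k\<close> edges; hence \<open>\<epsilon> |A| \<le> k |halo A|\<close>.\<close>

lemma finite_edges: "finite_graph G \<Longrightarrow> finite (edges G)"
  unfolding finite_graph_def by (meson Pow_iff finite_Pow_iff finite_subset subsetI)

lemma adj_Image_subset_verts: "finite_graph G \<Longrightarrow> adj G `` S \<subseteq> verts G"
  unfolding finite_graph_def adj_def by auto

text \<open>Once \<open>w\<close> is fixed, the edge \<open>{w, v}\<close> determines
  \<open>v\<close>.\<close>

lemma card_neighbours_le_degree:
  assumes "finite_graph G"
  shows "card (adj G `` {w}) \<le> vertex_degree G w"
  unfolding vertex_degree_def
proof (rule card_inj_on_le)
  show "inj_on (\<lambda>v. {w, v}) (adj G `` {w})"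
    by (auto simp: inj_on_def doubleton_eq_iff)
  show "(\<lambda>v. {w, v}) ` (adj G `` {w}) \<subseteq> {e \<in> edges G. w \<in> e}"
    by (auto simp: adj_def)
  show "finite {e \<in> edges G. w \<in> e}"
    using finite_edges[OF assms] by simp
qed

text \<open>Each end of a walk of length \<open>n\<close> extends in at most \<open>k\<close> ways.
  The inclusion is proved in the same induction because the degree bound holds only on
  \<open>verts G\<close>; it also gives finiteness.\<close>

lemma card_relpow_Image_le:
  assumes "finite_graph G" and "\<forall>v\<in>verts G. vertex_degree G v \<le> k" and "u \<in> verts G"
  shows "(adj G ^^ n) `` {u} \<subseteq> verts G \<and> card ((adj G ^^ n) `` {u}) \<le> k ^ n"
proof (induction n)
  case 0
  then show ?case using assms(3) by auto
next
  case (Suc n)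
  let ?S = "(adj G ^^ n) `` {u}"
  have fin: "finite ?S"
    using Suc assms(1) by (meson finite_graph_def finite_subset)
  have eq: "(adj G ^^ Suc n) `` {u} = (\<Union>w\<in>?S. adj G `` {w})"
    by auto
  have "card (\<Union>w\<in>?S. adj G `` {w}) \<le> (\<Sum>w\<in>?S. card (adj G `` {w}))"
    using fin by (rule card_UN_le)
  also have "\<dots> \<le> card ?S * k"
    using Suc assms(2) card_neighbours_le_degree[OF assms(1)]
    by (metis (no_types, lifting) of_nat_id order_trans subsetD sum_bounded_above)
  also have "\<dots> \<le> k ^ Suc n"
    using Suc by simp
  finally show ?case
    unfolding eq using adj_Image_subset_verts[OF assms(1)] by blast
qed

text \<open>Connectedness supplies some walk, so the \<open>LEAST\<close> in \<open>gdist\<close> is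
  attained.\<close>

lemma relpow_gdist:
  assumes "connected_graph G" "u \<in> verts G" "v \<in> verts G"
  shows "(u, v) \<in> adj G ^^ gdist G u v"
proof -
  have "\<exists>n. (u, v) \<in> adj G ^^ n"
    using assms rtrancl_imp_relpow unfolding connected_graph_def by blast
  then show ?thesis
    unfolding gdist_def by (rule LeastI_ex)
qed

text \<open>Finiteness of \<open>A\<close> bounds the set of distances, so the \<open>SUP\<close>
  over naturals is a genuine upper bound.\<close>

lemma gdist_le_gdiam:
  assumes "finite A" "u \<in> A" "v \<in> A"
  shows "gdist G u v \<le> gdiam G A"
proof -
  have "(\<lambda>(u, v). gdist G u v) (u, v) \<le> gdiam G A"
    unfolding gdiam_def by (rule cSUP_upper) (use assms in auto)
  then show ?thesis by simp
qed

text \<open>Seen from a fixed \<open>u\<close> in \<open>A\<close>, every vertex of \<open>A\<close>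
  ends a walk of some length \<open>n \<le> D\<close>, and at most \<open>k ^ n\<close> vertices end
  walks of length \<open>n\<close>.\<close>

lemma card_le_gdiam:
  assumes "finite_graph G" "connected_graph G" "\<forall>v\<in>verts G. vertex_degree G v \<le> k"
    and "A \<subseteq> verts G" "gdiam G A \<le> D"
  shows "card A \<le> (\<Sum>n\<le>D. k ^ n)"
proof (cases "A = {}")
  case False
  then obtain u where u: "u \<in> A" by blast
  have finV: "finite (verts G)" using assms(1) by (simp add: finite_graph_def)
  have finA: "finite A" using finV assms(4) by (rule rev_finite_subset)
  have ball: "(adj G ^^ n) `` {u} \<subseteq> verts G" "card ((adj G ^^ n) `` {u}) \<le> k ^ n" for n
    using card_relpow_Image_le[OF assms(1,3)] u assms(4) by blast+
  have "A \<subseteq> (\<Union>n\<le>D. (adj G ^^ n) `` {u})"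
  proof
    fix v assume v: "v \<in> A"
    have "gdist G u v \<le> D"
      using gdist_le_gdiam[OF finA u v] assms(5) by (rule order_trans)
    moreover have "(u, v) \<in> adj G ^^ gdist G u v"
      using relpow_gdist[OF assms(2)] u v assms(4) by blast
    ultimately show "v \<in> (\<Union>n\<le>D. (adj G ^^ n) `` {u})" by auto
  qed
  moreover have "finite (\<Union>n\<le>D. (adj G ^^ n) `` {u})"
    using ball(1) finV by (intro finite_UN_I) (auto intro: finite_subset)
  ultimately have "card A \<le> card (\<Union>n\<le>D. (adj G ^^ n) `` {u})"
    by (rule card_mono[rotated])
  also have "\<dots> \<le> (\<Sum>n\<le>D. card ((adj G ^^ n) `` {u}))"
    by (rule card_UN_le) simp
  also have "\<dots> \<le> (\<Sum>n\<le>D. k ^ n)"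
    by (rule sum_mono) (rule ball(2))
  finally show ?thesis .
qed simp

lemma adjacent_in_halo:
  assumes "{u, v} \<in> edges G" "u \<in> A" "A \<subseteq> verts G" "v \<in> verts G - A"
  shows "v \<in> halo G A"
proof -
  \<comment> \<open>The edge is traversed from \<open>v\<close>, since the balls in
    \<open>halo\<close> are centred outside \<open>A\<close>.\<close>
  have "(v, u) \<in> adj G ^^ 1"
    using assms(1) by (simp add: adj_def insert_commute)
  then have "gdist G v u \<le> 1"
    unfolding gdist_def by (rule Least_le)
  then have "u \<in> open_gball G v 2"
    using assms by (auto simp: open_gball_def)
  then show ?thesis
    using assms by (auto simp: halo_def)
qed

lemma card_edge_boundary_le_halo:
  assumes "finite_graph G" "\<forall>v\<in>verts G. vertex_degree G v \<le> k" "A \<subseteq> verts G"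
  shows "card (edge_boundary G A) \<le> card (halo G A) * k"
proof -
  have haloV: "halo G A \<subseteq> verts G" by (auto simp: halo_def)
  then have fin: "finite (halo G A)"
    using assms(1) by (meson finite_graph_def finite_subset)
  have "edge_boundary G A \<subseteq> (\<Union>v\<in>halo G A. {e \<in> edges G. v \<in> e})"
    using adjacent_in_halo[OF _ _ assms(3)] by (fastforce simp: edge_boundary_def)
  moreover have "finite (\<Union>v\<in>halo G A. {e \<in> edges G. v \<in> e})"
    using fin finite_edges[OF assms(1)] by simp
  ultimately have "card (edge_boundary G A) \<le> card (\<Union>v\<in>halo G A. {e \<in> edges G. v \<in> e})"
    by (rule card_mono[rotated])
  also have "\<dots> \<le> (\<Sum>v\<in>halo G A. vertex_degree G v)"
    unfolding vertex_degree_def using fin by (rule card_UN_le)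
  also have "\<dots> \<le> card (halo G A) * k"
    using sum_bounded_above[of "halo G A" "vertex_degree G" k] assms(2) haloV by auto
  finally show ?thesis .
qed

text \<open>\<open>A\<close> is one of the competitors in the infimum, and its positive cardinality
  allows the quotient to be cleared.\<close>

lemma edge_boundary_ge_cheeger:
  assumes "ereal \<epsilon> \<le> cheeger G" "A \<subseteq> verts G" "0 < card A" "2 * card A \<le> card (verts G)"
  shows "\<epsilon> * card A \<le> card (edge_boundary G A)"
proof -
  have "cheeger G \<le> ereal (card (edge_boundary G A) / card A)"
    unfolding cheeger_def by (rule INF_lower) (use assms in auto)
  then have "\<epsilon> \<le> card (edge_boundary G A) / card A"
    using assms(1) by (metis ereal_less_eq(3) order_trans)
  then show ?thesis
    using assms(3) by (simp add: field_simps)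
qed

theorem proposition7p7:
  fixes G :: "nat \<Rightarrow> 'a graph"
  assumes "expander_sequence G"
  shows "expander_light_sequence G"
proof -
  have seq: "graph_sequence G"
    using assms by (simp add: expander_sequence_def)
  then have conn: "connected_graph (G n)" for n
    by (simp add: graph_sequence_def)
  obtain k \<epsilon> where "\<And>i. expander k \<epsilon> (G i)"
    using assms by (auto simp: expander_sequence_def)
  then have fin: "finite_graph (G n)" and deg: "\<forall>v\<in>verts (G n). vertex_degree (G n) v \<le> k"
    and che: "ereal \<epsilon> \<le> cheeger (G n)" and eps: "\<epsilon> > 0" for n
    by (auto simp: expander_def)
  \<comment> \<open>\<open>k + 1\<close> instead of \<open>k\<close> avoids a division by zero.\<close>
  let ?c = "\<epsilon> / (real k + 1)"
  \<comment> \<open>\<open>?c\<close> is fixed before \<open>A\<close>; the diameter bound of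
    \<open>A\<close> affects only the index from which the inequality holds.\<close>
  have "infinite {n. ?c * card (A n) \<le> card (halo (G n) (A n))}"
    if sub: "\<forall>n. A n \<subseteq> verts (G n)" and bdd: "uniformly_bounded G A" for A
  proof -
    obtain D where D: "\<And>n. gdiam (G n) (A n) \<le> D"
      using bdd by (auto simp: uniformly_bounded_def)
    \<comment> \<open>By \<open>card_le_gdiam\<close> this bounds every \<open>card (A n)\<close>.
      It does not depend on \<open>n\<close>, so the growing orders eventually exceed twice its
      value.\<close>
    let ?N = "\<Sum>i\<le>D. k ^ i"
    have "\<forall>\<^sub>F n in sequentially. 2 * ?N \<le> card (verts (G n))"
      using seq by (simp add: graph_sequence_def filterlim_at_top)
    then have "\<forall>\<^sub>F n in sequentially. ?c * card (A n) \<le> card (halo (G n) (A n))"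
    proof eventually_elim
      case (elim n)
      have small: "2 * card (A n) \<le> card (verts (G n))"
        using card_le_gdiam[OF fin conn deg _ D, of n] sub elim by force
      show ?case
      \<comment> \<open>The empty set is not admissible for the Cheeger constant, but then the
        left-hand side is 0.\<close>
      proof (cases "card (A n) = 0")
        case False
        then have "\<epsilon> * card (A n) \<le> card (edge_boundary (G n) (A n))"
          using edge_boundary_ge_cheeger[OF che] sub small by blast
        also have "\<dots> \<le> real (card (halo (G n) (A n)) * k)"
          using card_edge_boundary_le_halo[OF fin deg] sub by (simp only: of_nat_le_iff)
        also have "\<dots> \<le> card (halo (G n) (A n)) * (real k + 1)"
          by (simp add: algebra_simps)
        finally show ?thesis
          by (simp add: field_simps)
      qed simp
    qed
    \<comment> \<open>What holds eventually holds frequently, and on the naturals frequently means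
      for infinitely many \<open>n\<close>.\<close>
    then show ?thesis
      by (metis eventually_frequently frequently_cofinite cofinite_eq_sequentially
          trivial_limit_sequentially)
  qed
  moreover have "?c > 0"
    using eps by simp
  ultimately show ?thesis
    using seq unfolding expander_light_sequence_def by blast
qed

end
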